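(* Line Search Shift is consistent: for every mode $x_*$ of $f$ and every $x_0$ in the basin of attraction of $x_*$, there is $\rho_0>0$ such that for all $\rho\in(0,\rho_0]$ the Line Search Shift sequence with parameter $\rho$ initialized at $x_0$ converges to $x_*$.
   Context: Density. $f$ is a probability density on $\mathbb{R}^d$ with respect to Lebesgue measure such that: (i) $f(x)\to0$ as $\|x\|\to\infty$; (ii) $f$ is twice differentiable everywhere, and $f$, $\nabla f$, $\nabla^2 f$ are bounded and uniformly continuous; (iii) the Hessian $\nabla^2 f$ is non-singular at every critical point of $f$. A mode is a local maximum of $f$. Gradient flow. For $x\in\mathbb{R}^d$, $\gamma_x:[0,\infty)\to\mathbb{R}^d$ is the solution of $\gamma_x(0)=x$, $\dot\gamma_x(t)=\nabla f(\gamma_x(t))$; $\gamma_x(t)$ converges to a critical point of $f$ as $t\to\infty$, denoted $\gamma_x(\infty)$. The basin of attraction of $x_*$ is $\{x:\gamma_x(\infty)=x_*\}$. Line Search Shift. Given $\rho>0$ and a starting point $x_0$: $x(0)=x_0$ and, for $k\ge0$, $x(k+1)=x(k)+\rho_k\nabla f(x(k))$ with $\rho_k\in\operatorname{arg\,max}_{r\in[0,\rho]}f\big(x(k)+r\nabla f(x(k))\big)$, ties being broken in an arbitrary but deterministic way. *)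

theory Defs
  imports "HOL-Analysis.Analysis"
begin

definition grad :: "(real ^ 'd \<Rightarrow> real) \<Rightarrow> real ^ 'd \<Rightarrow> real ^ 'd" where
  "grad f x = (THE D. GDERIV f x :> D)"

lemma grad_eqI:
  assumes "GDERIV f x :> D"
  shows "grad f x = D"
  unfolding grad_def
proof (rule the_equality)
  fix D' assume "GDERIV f x :> D'"
  with assms have "(\<lambda>h. h \<bullet> D') = (\<lambda>h. h \<bullet> D)"
    unfolding gderiv_def by (metis has_derivative_unique)
  then show "D' = D"
    by (metis vector_eq_ldot)
qed (fact assms)

definition hessian :: "(real ^ 'd \<Rightarrow> real) \<Rightarrow> real ^ 'd \<Rightarrow> real ^ 'd ^ 'd" where
  "hessian f x = jacobian (grad f) (at x)"

definition probability_density :: "(real ^ 'd \<Rightarrow> real) \<Rightarrow> bool" where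
  "probability_density f \<longleftrightarrow>
     (\<forall>x. 0 \<le> f x) \<and> integrable lborel f \<and> integral\<^sup>L lborel f = 1"

definition critical_point :: "(real ^ 'd \<Rightarrow> real) \<Rightarrow> real ^ 'd \<Rightarrow> bool" where
  "critical_point f x \<longleftrightarrow> grad f x = 0"

definition is_mode :: "(real ^ 'd \<Rightarrow> real) \<Rightarrow> real ^ 'd \<Rightarrow> bool" where
  "is_mode f x \<longleftrightarrow> (\<exists>e>0. \<forall>y\<in>ball x e. f y \<le> f x)"

definition regular_density :: "(real ^ 'd \<Rightarrow> real) \<Rightarrow> bool" where
  "regular_density f \<longleftrightarrow>
     probability_density f \<and>
     (f \<longlongrightarrow> 0) at_infinity \<and>
     (\<forall>x. f differentiable (at x)) \<and> (\<forall>x. grad f differentiable (at x)) \<and>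
     bounded (range f) \<and> uniformly_continuous_on UNIV f \<and>
     bounded (range (grad f)) \<and> uniformly_continuous_on UNIV (grad f) \<and>
     bounded (range (hessian f)) \<and> uniformly_continuous_on UNIV (hessian f) \<and>
     (\<forall>x. critical_point f x \<longrightarrow> invertible (hessian f x))"

(* Curves are total functions on the reals; only their values on [0, \<infinity>) matter,
   and the derivative at time 0 is one-sided. *)
definition gradient_flow_line ::
    "(real ^ 'd \<Rightarrow> real) \<Rightarrow> real ^ 'd \<Rightarrow> (real \<Rightarrow> real ^ 'd) \<Rightarrow> bool" where
  "gradient_flow_line f x \<gamma> \<longleftrightarrow>
     \<gamma> 0 = x \<and>
     (\<forall>t\<ge>0. (\<gamma> has_vector_derivative grad f (\<gamma> t)) (at t within {0..}))"

(* For a gradient that is Lipschitz, as here, the flow line from x exists and is unique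
   on [0, \<infinity>), so the existential refers to "the" flow line. *)
definition basin_of_attraction :: "(real ^ 'd \<Rightarrow> real) \<Rightarrow> real ^ 'd \<Rightarrow> (real ^ 'd) set" where
  "basin_of_attraction f z =
     {x. \<exists>\<gamma>. gradient_flow_line f x \<gamma> \<and> (\<gamma> \<longlongrightarrow> z) at_top}"

(* A deterministic way of breaking ties: for each parameter \<rho> and current point x,
   one fixed maximiser of f over the segment from x to x + \<rho> grad f x. *)
definition line_search_rule ::
    "(real ^ 'd \<Rightarrow> real) \<Rightarrow> (real \<Rightarrow> real ^ 'd \<Rightarrow> real) \<Rightarrow> bool" where
  "line_search_rule f s \<longleftrightarrow>
     (\<forall>\<rho>>0. \<forall>x. is_arg_max (\<lambda>r. f (x + r *\<^sub>R grad f x)) (\<lambda>r. r \<in> {0..\<rho>}) (s \<rho> x))"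

primrec line_search_shift ::
    "(real ^ 'd \<Rightarrow> real) \<Rightarrow> (real \<Rightarrow> real ^ 'd \<Rightarrow> real) \<Rightarrow> real \<Rightarrow> real ^ 'd \<Rightarrow> nat \<Rightarrow> real ^ 'd"
  where
    "line_search_shift f s \<rho> x\<^sub>0 0 = x\<^sub>0"
  | "line_search_shift f s \<rho> x\<^sub>0 (Suc k) =
       (let x = line_search_shift f s \<rho> x\<^sub>0 k in x + s \<rho> x *\<^sub>R grad f x)"

end

theory Submission
  imports Defs
begin

text \<open>
  For steps shorter than half the inverse Lipschitz constant of the gradient, \<^term>\<open>f\<close> is strictly
  increasing along the whole segment that is searched, unless its starting point is critical. The
  only maximiser is then the far end, so the line search is an Euler step for the gradient
  flow (\<open>line_search_eq_euler\<close>).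

  Two facts about Euler's scheme finish the argument. Over a bounded time span the Euler points
  follow the flow line with an error of the order of the step (\<open>euler_error\<close>), so for small steps
  they enter any given neighbourhood of the mode. Near the mode they cannot escape: an
  invertible Hessian makes the mode an isolated critical point, hence a strict local maximum,
  and on a small sphere around it \<^term>\<open>f\<close> stays below some level less than its value at the mode.
  Since \<^term>\<open>f\<close> increases along each step, an Euler point inside the sphere and above this level
  has its successors there too. The values then increase and are bounded, which forces the gradients
  at the Euler points to tend to 0, and inside the sphere only the mode has zero
  gradient (\<open>euler_trapped_tendsto\<close>).
\<close>

section \<open>Euler's scheme for a bounded Lipschitz gradient\<close>

locale bounded_lipschitz_gradient =
  fixes f :: "'a::euclidean_space \<Rightarrow> real" and G :: "'a \<Rightarrow> 'a" and L M :: real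
  assumes gderiv: "GDERIV f x :> G x"
    and L_pos: "L > 0"
    and lipschitz: "norm (G x - G y) \<le> L * norm (x - y)"
    and bounded_gradient: "norm (G x) \<le> M"
begin

definition euler :: "real \<Rightarrow> 'a \<Rightarrow> nat \<Rightarrow> 'a" where
  "euler \<rho> x k = ((\<lambda>y. y + \<rho> *\<^sub>R G y) ^^ k) x"

lemma euler_0 [simp]: "euler \<rho> x 0 = x"
  and euler_Suc [simp]: "euler \<rho> x (Suc k) = euler \<rho> x k + \<rho> *\<^sub>R G (euler \<rho> x k)"
  by (simp_all add: euler_def)

lemma euler_add: "euler \<rho> x (k + m) = euler \<rho> (euler \<rho> x m) k"
  by (simp add: euler_def funpow_add)

lemma M_nonneg: "M \<ge> 0"
  using order_trans[OF norm_ge_zero bounded_gradient] .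

lemma continuous_f: "continuous_on S f"
  using gderiv unfolding gderiv_def
  by (meson continuous_at_imp_continuous_on has_derivative_continuous)

lemma continuous_G: "continuous_on S G"
proof -
  have "L-lipschitz_on S G"
    by (rule lipschitz_onI) (use lipschitz L_pos in \<open>auto simp: dist_norm\<close>)
  then show ?thesis by (rule lipschitz_on_continuous_on)
qed

lemma gradient_zero_at_local_max:
  assumes "r > 0" "\<And>y. y \<in> ball x r \<Longrightarrow> f y \<le> f x"
  shows "G x = 0"
proof -
  have "(\<lambda>h. h \<bullet> G x) = (\<lambda>v. 0)"
    by (rule differential_zero_maxmin[of x "ball x r" f])
       (use assms gderiv in \<open>auto simp: gderiv_def\<close>)
  then show ?thesis by (metis inner_eq_zero_iff)
qed

text \<open>
  Up to time \<open>1 / (2 * L)\<close> the gradient has turned so little along the ray that its component in the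
  direction of \<^term>\<open>G x\<close> is still at least half of its initial value.
\<close>
lemma euler_step_gain:
  assumes "0 \<le> a" "a \<le> b" "b \<le> 1 / (2 * L)"
  shows "f (x + b *\<^sub>R G x) - f (x + a *\<^sub>R G x) \<ge> (b - a) / 2 * (norm (G x))\<^sup>2"
proof (cases "a = b")
  case False
  then have "a < b" using assms by simp
  let ?h = "\<lambda>r. f (x + r *\<^sub>R G x)"
  have deriv: "(?h has_real_derivative (G x \<bullet> G (x + r *\<^sub>R G x))) (at r)" for r
  proof -
    have "(f has_derivative (\<lambda>h. h \<bullet> G (x + r *\<^sub>R G x))) (at (x + r *\<^sub>R G x))"
      using gderiv by (simp add: gderiv_def)
    moreover have "((\<lambda>r. x + r *\<^sub>R G x) has_derivative (\<lambda>h. h *\<^sub>R G x)) (at r)"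
      by (auto intro!: derivative_eq_intros)
    ultimately have "(?h has_derivative (\<lambda>h. (h *\<^sub>R G x) \<bullet> G (x + r *\<^sub>R G x))) (at r)"
      by (rule has_derivative_compose[rotated])
    moreover have "(\<lambda>h. (h *\<^sub>R G x) \<bullet> G (x + r *\<^sub>R G x)) = (*) (G x \<bullet> G (x + r *\<^sub>R G x))"
      by (simp add: fun_eq_iff)
    ultimately show ?thesis by (simp only: has_field_derivative_def)
  qed
  obtain c where c: "a < c" "c < b"
    and mvt: "?h b - ?h a = (b - a) * (G x \<bullet> G (x + c *\<^sub>R G x))"
    using MVT2[OF \<open>a < b\<close>, of ?h "\<lambda>r. G x \<bullet> G (x + r *\<^sub>R G x)"] deriv by blast
  have "L * c \<le> L * (1 / (2 * L))" using c assms L_pos by (intro mult_left_mono) auto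
  then have cL: "L * c \<le> 1 / 2" using L_pos by simp
  have "norm (G (x + c *\<^sub>R G x) - G x) \<le> L * norm (c *\<^sub>R G x)"
    using lipschitz[of "x + c *\<^sub>R G x" x] by simp
  also have "\<dots> = (L * c) * norm (G x)" using c assms by simp
  also have "\<dots> \<le> 1 / 2 * norm (G x)" using cL by (intro mult_right_mono) auto
  finally have close: "norm (G (x + c *\<^sub>R G x) - G x) \<le> norm (G x) / 2" by simp
  have "\<bar>G x \<bullet> (G (x + c *\<^sub>R G x) - G x)\<bar> \<le> norm (G x) * norm (G (x + c *\<^sub>R G x) - G x)"
    by (rule Cauchy_Schwarz_ineq2)
  also have "\<dots> \<le> norm (G x) * (norm (G x) / 2)"
    using close by (intro mult_left_mono) auto
  finally have "\<bar>G x \<bullet> G (x + c *\<^sub>R G x) - (norm (G x))\<^sup>2\<bar> \<le> (norm (G x))\<^sup>2 / 2"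
    by (simp add: inner_diff_right power2_norm_eq_inner[symmetric] power2_eq_square)
  then have "G x \<bullet> G (x + c *\<^sub>R G x) \<ge> (norm (G x))\<^sup>2 / 2"
    by linarith
  then have "(b - a) * (G x \<bullet> G (x + c *\<^sub>R G x)) \<ge> (b - a) * ((norm (G x))\<^sup>2 / 2)"
    using \<open>a < b\<close> by (intro mult_left_mono) auto
  then show ?thesis using mvt by simp
qed simp

text \<open>
  The local error of one step is \<open>L * M * \<rho>\<^sup>2\<close>, because the speed of a flow line is at most \<^term>\<open>M\<close>
  and hence its velocity changes by at most \<open>L * M * \<rho>\<close>.
\<close>
lemma euler_local_error:
  assumes flow: "\<And>t. t \<ge> 0 \<Longrightarrow> (\<gamma> has_vector_derivative G (\<gamma> t)) (at t within {0..})"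
    and t: "t \<ge> 0" and \<rho>: "\<rho> \<ge> 0"
  shows "norm (\<gamma> (t + \<rho>) - \<gamma> t - \<rho> *\<^sub>R G (\<gamma> t)) \<le> L * M * \<rho>\<^sup>2"
proof -
  let ?I = "{t..t + \<rho>}"
  have vd: "(\<gamma> has_vector_derivative G (\<gamma> u)) (at u within ?I)" if "u \<in> ?I" for u
    by (rule has_vector_derivative_within_subset[OF flow]) (use that t in auto)
  have speed: "norm (\<gamma> u - \<gamma> t) \<le> M * \<rho>" if "u \<in> ?I" for u
  proof -
    have "norm (\<gamma> u - \<gamma> t) \<le> M * norm (u - t)"
    proof (rule differentiable_bound[of ?I \<gamma> "\<lambda>v h. h *\<^sub>R G (\<gamma> v)"])
      fix v assume "v \<in> ?I"
      then show "(\<gamma> has_derivative (\<lambda>h. h *\<^sub>R G (\<gamma> v))) (at v within ?I)"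
        using vd by (simp add: has_vector_derivative_def)
      show "onorm (\<lambda>h. h *\<^sub>R G (\<gamma> v)) \<le> M"
      proof (rule onorm_le)
        fix h :: real
        show "norm (h *\<^sub>R G (\<gamma> v)) \<le> M * norm h"
          using mult_left_mono[OF bounded_gradient, of "\<bar>h\<bar>" "\<gamma> v"] by (simp add: mult.commute)
      qed
    qed (use that \<rho> in auto)
    also have "\<dots> \<le> M * \<rho>"
      using that M_nonneg by (intro mult_left_mono) auto
    finally show ?thesis .
  qed
  let ?g = "\<lambda>u. \<gamma> u - u *\<^sub>R G (\<gamma> t)"
  have "norm (?g (t + \<rho>) - ?g t) \<le> (L * (M * \<rho>)) * norm (t + \<rho> - t)"
  proof (rule differentiable_bound[of ?I ?g "\<lambda>v h. h *\<^sub>R (G (\<gamma> v) - G (\<gamma> t))"])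
    fix v assume v: "v \<in> ?I"
    show "(?g has_derivative (\<lambda>h. h *\<^sub>R (G (\<gamma> v) - G (\<gamma> t)))) (at v within ?I)"
      using vd[OF v] unfolding has_vector_derivative_def
      by (auto intro!: derivative_eq_intros simp: scaleR_diff_right)
    have "norm (G (\<gamma> v) - G (\<gamma> t)) \<le> L * norm (\<gamma> v - \<gamma> t)" by (rule lipschitz)
    also have "\<dots> \<le> L * (M * \<rho>)" using speed[OF v] L_pos by (intro mult_left_mono) auto
    finally have le: "norm (G (\<gamma> v) - G (\<gamma> t)) \<le> L * (M * \<rho>)" .
    show "onorm (\<lambda>h. h *\<^sub>R (G (\<gamma> v) - G (\<gamma> t))) \<le> L * (M * \<rho>)"
    proof (rule onorm_le)
      fix h :: real
      show "norm (h *\<^sub>R (G (\<gamma> v) - G (\<gamma> t))) \<le> L * (M * \<rho>) * norm h"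
        using mult_left_mono[OF le, of "\<bar>h\<bar>"] by (simp add: mult.commute)
    qed
  qed (use \<rho> in auto)
  then show ?thesis
    using \<rho> by (simp add: power2_eq_square algebra_simps)
qed

text \<open>
  Local errors add up, each amplified by a factor of at most \<open>1 + L * \<rho>\<close> per later step; for the elapsed
  time \<open>k * \<rho>\<close> the amplification is at most \<open>exp (L * (k * \<rho>))\<close>.
\<close>
lemma euler_error:
  assumes flow: "\<And>t. t \<ge> 0 \<Longrightarrow> (\<gamma> has_vector_derivative G (\<gamma> t)) (at t within {0..})"
    and \<rho>: "\<rho> \<ge> 0"
  shows "norm (\<gamma> (real k * \<rho>) - euler \<rho> (\<gamma> 0) k) \<le> exp (L * (k * \<rho>)) * (L * M * (k * \<rho>) * \<rho>)"
proof -
  let ?x = "euler \<rho> (\<gamma> 0)" and ?q = "1 + L * \<rho>"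
  have q1: "?q \<ge> 1" using L_pos \<rho> by simp
  have "norm (\<gamma> (real k * \<rho>) - ?x k) \<le> ?q ^ k * (k * (L * M * \<rho>\<^sup>2))"
  proof (induction k)
    case (Suc k)
    let ?t = "real k * \<rho>"
    have "\<gamma> (real (Suc k) * \<rho>) - ?x (Suc k) = (\<gamma> (?t + \<rho>) - \<gamma> ?t - \<rho> *\<^sub>R G (\<gamma> ?t))
        + ((\<gamma> ?t - ?x k) + \<rho> *\<^sub>R (G (\<gamma> ?t) - G (?x k)))"
      by (simp add: algebra_simps)
    also have "norm \<dots> \<le> L * M * \<rho>\<^sup>2 + (norm (\<gamma> ?t - ?x k) + \<rho> * (L * norm (\<gamma> ?t - ?x k)))"
    proof (rule norm_triangle_le, rule add_mono)
      show "norm (\<gamma> (?t + \<rho>) - \<gamma> ?t - \<rho> *\<^sub>R G (\<gamma> ?t)) \<le> L * M * \<rho>\<^sup>2"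
        by (rule euler_local_error[OF flow]) (use \<rho> in auto)
      have "norm (\<rho> *\<^sub>R (G (\<gamma> ?t) - G (?x k))) \<le> \<rho> * (L * norm (\<gamma> ?t - ?x k))"
        using mult_left_mono[OF lipschitz \<rho>] \<rho> by simp
      then show "norm ((\<gamma> ?t - ?x k) + \<rho> *\<^sub>R (G (\<gamma> ?t) - G (?x k)))
          \<le> norm (\<gamma> ?t - ?x k) + \<rho> * (L * norm (\<gamma> ?t - ?x k))"
        by (intro norm_triangle_le) simp
    qed
    also have "\<dots> = L * M * \<rho>\<^sup>2 + ?q * norm (\<gamma> ?t - ?x k)" by (simp add: algebra_simps)
    also have "\<dots> \<le> ?q ^ Suc k * (L * M * \<rho>\<^sup>2) + ?q * (?q ^ k * (k * (L * M * \<rho>\<^sup>2)))"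
    proof (rule add_mono)
      show "L * M * \<rho>\<^sup>2 \<le> ?q ^ Suc k * (L * M * \<rho>\<^sup>2)"
        using mult_right_mono[OF one_le_power[OF q1, of "Suc k"], of "L * M * \<rho>\<^sup>2"] L_pos M_nonneg
        by simp
      show "?q * norm (\<gamma> ?t - ?x k) \<le> ?q * (?q ^ k * (k * (L * M * \<rho>\<^sup>2)))"
        using Suc.IH q1 by (intro mult_left_mono) auto
    qed
    also have "\<dots> = ?q ^ Suc k * (Suc k * (L * M * \<rho>\<^sup>2))" by (simp add: algebra_simps)
    finally show ?case .
  qed simp
  also have "\<dots> \<le> exp (L * (k * \<rho>)) * (k * (L * M * \<rho>\<^sup>2))"
  proof (rule mult_right_mono)
    have "?q ^ k \<le> exp (L * \<rho>) ^ k"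
      using q1 by (intro power_mono exp_ge_add_one_self) auto
    also have "\<dots> = exp (L * (k * \<rho>))"
      by (simp add: exp_of_nat_mult[symmetric] algebra_simps)
    finally show "?q ^ k \<le> exp (L * (k * \<rho>))" .
  qed (use L_pos M_nonneg in auto)
  finally show ?thesis by (simp add: power2_eq_square mult_ac)
qed

text \<open>
  A step from inside the sphere, and from above the level \<^term>\<open>m\<close>, that ended outside would cross
  the sphere, where the value would have dropped to \<^term>\<open>m\<close> or below.
\<close>
lemma euler_step_trapped:
  assumes \<rho>: "0 < \<rho>" "\<rho> \<le> 1 / (2 * L)"
    and m: "\<And>y. y \<in> sphere z r \<Longrightarrow> f y \<le> m"
    and x: "x \<in> ball z r" "f x > m"
  shows "x + \<rho> *\<^sub>R G x \<in> ball z r" "f (x + \<rho> *\<^sub>R G x) > m"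
proof -
  have up: "f x \<le> f (x + t *\<^sub>R G x)" if "0 \<le> t" "t \<le> \<rho>" for t
  proof -
    have "0 \<le> (t - 0) / 2 * (norm (G x))\<^sup>2" using that by simp
    also have "\<dots> \<le> f (x + t *\<^sub>R G x) - f (x + 0 *\<^sub>R G x)"
      by (rule euler_step_gain) (use that \<rho> in auto)
    finally show ?thesis by simp
  qed
  show "f (x + \<rho> *\<^sub>R G x) > m" using up[of \<rho>] x \<rho> by simp
  show "x + \<rho> *\<^sub>R G x \<in> ball z r"
  proof (rule ccontr)
    assume "x + \<rho> *\<^sub>R G x \<notin> ball z r"
    then have "\<exists>t\<ge>0. t \<le> \<rho> \<and> dist z (x + t *\<^sub>R G x) = r"
      using x \<rho> by (intro IVT') (auto intro!: continuous_intros)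
    then obtain t where t: "0 \<le> t" "t \<le> \<rho>" "dist z (x + t *\<^sub>R G x) = r" by blast
    then show False using m[of "x + t *\<^sub>R G x"] up[of t] x by auto
  qed
qed

text \<open>
  Each step gains at least \<open>\<rho> / 2\<close> times the squared norm of the gradient, while the total gain
  is bounded, so the gradients tend to 0. By compactness the gradient is bounded away from 0 off any
  neighbourhood of its only zero \<^term>\<open>z\<close>.
\<close>
lemma euler_trapped_tendsto:
  assumes \<rho>: "0 < \<rho>" "\<rho> \<le> 1 / (2 * L)"
    and m: "\<And>y. y \<in> sphere z r \<Longrightarrow> f y \<le> m"
    and x: "x \<in> ball z r" "f x > m"
    and zmax: "\<And>y. y \<in> ball z r \<Longrightarrow> f y \<le> f z"
    and isolated: "\<And>y. y \<in> cball z r \<Longrightarrow> G y = 0 \<Longrightarrow> y = z"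
  shows "euler \<rho> x \<longlonglongrightarrow> z"
proof -
  let ?x = "euler \<rho> x"
  have inv: "?x k \<in> ball z r \<and> f (?x k) > m" for k
  proof (induction k)
    case 0
    show ?case using x by simp
  next
    case (Suc k)
    then show ?case unfolding euler_Suc using euler_step_trapped[OF \<rho> m] by blast
  qed
  have gain: "f (?x (Suc k)) - f (?x k) \<ge> \<rho> / 2 * (norm (G (?x k)))\<^sup>2" for k
    using euler_step_gain[of 0 \<rho> "?x k"] \<rho> by simp
  have "f (?x k) \<le> f (?x (Suc k))" for k
  proof -
    have "0 \<le> \<rho> / 2 * (norm (G (?x k)))\<^sup>2" using \<rho> by simp
    then show ?thesis using gain[of k] by linarith
  qed
  then have "incseq (\<lambda>k. f (?x k))" by (rule incseq_SucI)
  then obtain l where l: "(\<lambda>k. f (?x k)) \<longlonglongrightarrow> l"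
    using incseq_convergent[of "\<lambda>k. f (?x k)" "f z"] inv zmax by blast
  have "(\<lambda>k. (f (?x (Suc k)) - f (?x k)) / (\<rho> / 2)) \<longlonglongrightarrow> (l - l) / (\<rho> / 2)"
    using \<rho> by (intro tendsto_intros LIMSEQ_Suc[OF l] l) auto
  then have "(\<lambda>k. (f (?x (Suc k)) - f (?x k)) / (\<rho> / 2)) \<longlonglongrightarrow> 0" by simp
  then have "(\<lambda>k. (norm (G (?x k)))\<^sup>2) \<longlonglongrightarrow> 0"
  proof (rule Lim_null_comparison[rotated])
    show "\<forall>\<^sub>F k in sequentially. norm ((norm (G (?x k)))\<^sup>2) \<le> (f (?x (Suc k)) - f (?x k)) / (\<rho> / 2)"
      using gain \<rho> by (intro always_eventually) (simp add: field_simps)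
  qed
  then have "(\<lambda>k. sqrt ((norm (G (?x k)))\<^sup>2)) \<longlonglongrightarrow> sqrt 0"
    by (rule tendsto_real_sqrt)
  then have G0: "(\<lambda>k. norm (G (?x k))) \<longlonglongrightarrow> 0" by simp
  show ?thesis
  proof (rule tendstoI)
    fix e :: real assume "e > 0"
    let ?K = "cball z r - ball z e"
    have "\<exists>c>0. \<forall>y\<in>?K. c \<le> norm (G y)"
    proof (cases "?K = {}")
      case True
      then show ?thesis using zero_less_one by blast
    next
      case False
      have "compact ?K" by (intro compact_diff) auto
      then obtain w where w: "w \<in> ?K" "\<And>y. y \<in> ?K \<Longrightarrow> norm (G w) \<le> norm (G y)"
        using continuous_attains_inf[OF _ False, of "\<lambda>y. norm (G y)"]
        by (metis continuous_G continuous_on_norm)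
      have "norm (G w) > 0" using isolated[of w] w(1) \<open>e > 0\<close> by auto
      with w show ?thesis by blast
    qed
    then obtain c where c: "c > 0" "\<And>y. y \<in> ?K \<Longrightarrow> c \<le> norm (G y)" by blast
    have "\<forall>\<^sub>F k in sequentially. norm (G (?x k)) < c"
      using order_tendstoD(2)[OF G0 c(1)] .
    then show "\<forall>\<^sub>F k in sequentially. dist (?x k) z < e"
    proof eventually_elim
      case (elim k)
      then have "?x k \<notin> ?K" using c(2)[of "?x k"] by linarith
      then show ?case using inv[of k] by (auto simp: dist_commute)
    qed
  qed
qed

text \<open>
  A point near \<^term>\<open>z\<close> with the same value would be a local maximum too, hence a second critical
  point; so the maximum is strict and the sphere, being compact, lies below a level less
  than \<^term>\<open>f z\<close>.
\<close>
lemma sphere_below_isolated_max: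
  assumes "0 < r" "r < R"
    and zmax: "\<And>y. y \<in> ball z R \<Longrightarrow> f y \<le> f z"
    and isolated: "\<And>y. y \<in> ball z R \<Longrightarrow> G y = 0 \<Longrightarrow> y = z"
  shows "\<exists>m<f z. \<forall>y\<in>sphere z r. f y \<le> m"
proof -
  have "sphere z r \<noteq> {}" using \<open>0 < r\<close> by simp
  then obtain w where w: "w \<in> sphere z r" "\<And>y. y \<in> sphere z r \<Longrightarrow> f y \<le> f w"
    using continuous_attains_sup[OF compact_sphere _ continuous_f] by blast
  have wR: "w \<in> ball z R" using w(1) assms by simp
  have "f w \<noteq> f z"
  proof
    assume eq: "f w = f z"
    obtain e where e: "e > 0" "ball w e \<subseteq> ball z R"
      using wR open_contains_ball[of "ball z R"] by blast
    have "G w = 0"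
      by (rule gradient_zero_at_local_max[OF e(1)]) (use e zmax eq in auto)
    then show False using isolated[OF wR] w(1) \<open>0 < r\<close> by auto
  qed
  then have "f w < f z" using zmax[OF wR] by simp
  with w show ?thesis by blast
qed

text \<open>
  The trap is a whole neighbourhood of \<^term>\<open>z\<close>, independent of the step, whereas the tracking error
  at a fixed late time shrinks with the step; hence all small steps lead into the trap.
\<close>
lemma euler_tendsto_isolated_max:
  assumes flow: "\<And>t. t \<ge> 0 \<Longrightarrow> (\<gamma> has_vector_derivative G (\<gamma> t)) (at t within {0..})"
    and lim: "(\<gamma> \<longlongrightarrow> z) at_top"
    and R: "R > 0"
    and zmax: "\<And>y. y \<in> ball z R \<Longrightarrow> f y \<le> f z"
    and isolated: "\<And>y. y \<in> ball z R \<Longrightarrow> G y = 0 \<Longrightarrow> y = z"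
  shows "\<exists>\<rho>\<^sub>0>0. \<forall>\<rho>\<in>{0<..\<rho>\<^sub>0}. euler \<rho> (\<gamma> 0) \<longlonglongrightarrow> z"
proof -
  define r where "r = R / 2"
  have r: "0 < r" "r < R" using R by (auto simp: r_def)
  obtain m where m: "m < f z" "\<And>y. y \<in> sphere z r \<Longrightarrow> f y \<le> m"
    using sphere_below_isolated_max[OF r zmax isolated] by blast
  let ?V = "ball z r \<inter> {y. m < f y}"
  have "open ?V"
    by (intro open_Int open_ball open_Collect_less continuous_f continuous_on_const)
  moreover have "z \<in> ?V" using r m by simp
  ultimately obtain e where e: "e > 0" "ball z e \<subseteq> ?V"
    by (meson open_contains_ball)
  have "\<forall>\<^sub>F t in at_top. dist (\<gamma> t) z < e / 2"
    using tendstoD[OF lim, of "e / 2"] e by simp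
  then obtain T0 where T0: "\<And>t. t \<ge> T0 \<Longrightarrow> dist (\<gamma> t) z < e / 2"
    by (auto simp: eventually_at_top_linorder)
  define T where "T = max T0 0"
  define C where "C = exp (L * (T + 1)) * (L * M * (T + 1)) + 1"
  have C: "C > 0" "exp (L * (T + 1)) * (L * M * (T + 1)) \<le> C"
    using L_pos M_nonneg by (auto simp: C_def T_def intro!: add_nonneg_pos)
  define \<rho>0 where "\<rho>0 = Min {1, 1 / (2 * L), e / (2 * C)}"
  have \<rho>0: "\<rho>0 > 0" "\<rho>0 \<le> 1" "\<rho>0 \<le> 1 / (2 * L)" "\<rho>0 \<le> e / (2 * C)"
    using L_pos e C by (auto simp: \<rho>0_def)
  have "euler \<rho> (\<gamma> 0) \<longlonglongrightarrow> z" if \<rho>: "\<rho> \<in> {0<..\<rho>0}" for \<rho>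
  proof -
    \<comment> \<open>The first step at or after time \<^term>\<open>T\<close>; it comes no later than \<open>T + 1\<close> because \<open>\<rho> \<le> 1\<close>.\<close>
    define n where "n = nat \<lceil>T / \<rho>\<rceil>"
    have T_nonneg: "T \<ge> 0" by (simp add: T_def)
    have n: "real n \<ge> T / \<rho>" "real n \<le> T / \<rho> + 1"
      using \<rho> T_nonneg by (auto simp: n_def intro!: order_trans[OF _ real_nat_ceiling_ge])
    have lo: "T \<le> n * \<rho>" and hi: "n * \<rho> \<le> T + 1"
    proof -
      show "T \<le> n * \<rho>" using n(1) \<rho> by (simp add: field_simps)
      have "n * \<rho> \<le> (T / \<rho> + 1) * \<rho>" using n(2) \<rho> by (intro mult_right_mono) auto
      also have "\<dots> = T + \<rho>" using \<rho> by (simp add: field_simps)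
      finally show "n * \<rho> \<le> T + 1" using \<rho> \<rho>0 by simp
    qed
    let ?y = "euler \<rho> (\<gamma> 0) n"
    have "norm (\<gamma> (n * \<rho>) - ?y) \<le> exp (L * (n * \<rho>)) * (L * M * (n * \<rho>) * \<rho>)"
      by (rule euler_error[OF flow]) (use \<rho> in auto)
    also have "\<dots> \<le> exp (L * (T + 1)) * (L * M * (T + 1) * \<rho>)"
      using hi \<rho> L_pos M_nonneg T_nonneg by (intro mult_mono) auto
    also have "\<dots> \<le> C * \<rho>"
      using mult_right_mono[OF C(2), of \<rho>] \<rho> by (simp add: mult_ac)
    also have "\<dots> \<le> C * (e / (2 * C))" using \<rho> \<rho>0 C by (intro mult_left_mono) auto
    finally have "dist (\<gamma> (n * \<rho>)) ?y \<le> e / 2" using C by (simp add: dist_norm)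
    moreover have "dist (\<gamma> (n * \<rho>)) z < e / 2" using lo T0 by (simp add: T_def)
    ultimately have "dist z ?y < e" by metric
    then have y: "?y \<in> ball z r" "f ?y > m" using e(2) by auto
    have "euler \<rho> ?y \<longlonglongrightarrow> z"
    proof (rule euler_trapped_tendsto[OF _ _ m(2) y])
      show "f y \<le> f z" if "y \<in> ball z r" for y using that zmax r by simp
      show "y = z" if "y \<in> cball z r" "G y = 0" for y using that isolated r by simp
    qed (use \<rho> \<rho>0 in auto)
    then have "(\<lambda>k. euler \<rho> (\<gamma> 0) (k + n)) \<longlonglongrightarrow> z" by (simp add: euler_add)
    then show ?thesis by (rule LIMSEQ_offset)
  qed
  then show ?thesis using \<rho>0(1) by blast
qed

end

section \<open>Regular densities and the line search\<close>

lemma gderiv_grad: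
  assumes "f differentiable (at x)"
  shows "GDERIV f x :> grad f x"
proof -
  obtain f' where f': "(f has_derivative f') (at x)"
    using assms by (auto simp: differentiable_def)
  then have lin: "linear f'" by (rule has_derivative_linear)
  have "f' = (\<lambda>h. h \<bullet> adjoint f' 1)"
  proof
    show "f' h = h \<bullet> adjoint f' 1" for h
      using adjoint_works[OF lin, of h 1] by simp
  qed
  then have "GDERIV f x :> adjoint f' 1"
    using f' by (simp only: gderiv_def)
  then show ?thesis using grad_eqI[of f x "adjoint f' 1"] by simp
qed

lemma grad_has_derivative_hessian:
  assumes "grad f differentiable (at x)"
  shows "(grad f has_derivative (*v) (hessian f x)) (at x)"
  using assms unfolding hessian_def by (simp add: jacobian_works)

lemma regular_density_bounded_lipschitz_gradient:
  assumes "regular_density f"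
  shows "\<exists>L M. bounded_lipschitz_gradient f (grad f) L M"
proof -
  have diff: "f differentiable (at x)" "grad f differentiable (at x)" for x
    using assms by (auto simp: regular_density_def)
  obtain M where M: "\<And>x. norm (grad f x) \<le> M"
    using assms by (auto simp: regular_density_def bounded_iff)
  obtain B where B: "\<And>x. norm (hessian f x) \<le> B"
    using assms by (auto simp: regular_density_def bounded_iff)
  define L where "L = real CARD('a) * real CARD('a) * B + 1"
  have B0: "B \<ge> 0" using order_trans[OF norm_ge_zero B] .
  have on: "onorm ((*v) (hessian f x)) \<le> L" for x
  proof -
    have "\<bar>hessian f x $ i $ j\<bar> \<le> B" for i j
      using component_le_norm_cart[of "hessian f x $ i" j] Finite_Cartesian_Product.norm_nth_le[of "hessian f x" i] B[of x]
      by linarith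
    then have "onorm ((*v) (hessian f x)) \<le> real CARD('a) * real CARD('a) * B"
      by (rule onorm_le_matrix_component)
    then show ?thesis by (simp add: L_def)
  qed
  have "bounded_lipschitz_gradient f (grad f) L M"
  proof
    show "GDERIV f x :> grad f x" for x by (rule gderiv_grad) (rule diff)
    show "L > 0" using B0 by (auto simp: L_def intro!: add_nonneg_pos)
    show "norm (grad f x) \<le> M" for x by (rule M)
    show "norm (grad f x - grad f y) \<le> L * norm (x - y)" for x y
      by (rule differentiable_bound[of UNIV "grad f" "\<lambda>x. (*v) (hessian f x)"])
         (use grad_has_derivative_hessian[OF diff(2)] on in auto)
  qed
  then show ?thesis by blast
qed

text \<open>
  An invertible derivative expands all vectors by at least a fixed factor, and this
  persists to first order around a zero.
\<close>
lemma zero_isolated_if_derivative_inj: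
  fixes g :: "'a::euclidean_space \<Rightarrow> 'b::euclidean_space"
  assumes g': "(g has_derivative g') (at z)" and "inj g'" and "g z = 0"
  shows "\<exists>r>0. \<forall>y\<in>ball z r. g y = 0 \<longrightarrow> y = z"
proof -
  have "linear g'" using g' by (rule has_derivative_linear)
  then obtain c where c: "c > 0" "\<And>h. c * norm h \<le> norm (g' h)"
    using linear_inj_bounded_below_pos \<open>inj g'\<close> by metis
  obtain r where r: "r > 0"
    "\<And>y. norm (y - z) < r \<Longrightarrow> norm (g y - g z - g' (y - z)) \<le> c / 2 * norm (y - z)"
    using g' c(1) unfolding has_derivative_at_alt by (metis half_gt_zero)
  have "y = z" if "y \<in> ball z r" "g y = 0" for y
  proof -
    have "c * norm (y - z) \<le> norm (g' (y - z))" by (rule c)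
    also have "\<dots> \<le> c / 2 * norm (y - z)"
      using r(2)[of y] that \<open>g z = 0\<close> by (simp add: dist_norm norm_minus_commute)
    finally have "c * norm (y - z) \<le> 0" by simp
    then show ?thesis using c(1) by (simp add: mult_le_0_iff)
  qed
  with r(1) show ?thesis by blast
qed

text \<open>
  At a critical point the two schemes agree because neither moves, whatever value the rule selects.
\<close>
lemma line_search_eq_euler:
  assumes "bounded_lipschitz_gradient f (grad f) L M"
    and rule: "line_search_rule f s"
    and \<rho>: "0 < \<rho>" "\<rho> \<le> 1 / (2 * L)"
  shows "line_search_shift f s \<rho> x k = bounded_lipschitz_gradient.euler (grad f) \<rho> x k"
proof -
  interpret bounded_lipschitz_gradient f "grad f" L M by fact
  have step: "s \<rho> y *\<^sub>R grad f y = \<rho> *\<^sub>R grad f y" for y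
  proof (cases "grad f y = 0")
    case False
    have range: "s \<rho> y \<in> {0..\<rho>}"
      and max: "\<not> f (y + \<rho> *\<^sub>R grad f y) > f (y + s \<rho> y *\<^sub>R grad f y)"
      using rule \<rho>(1) by (auto simp: line_search_rule_def is_arg_max_def)
    have "(\<rho> - s \<rho> y) / 2 * (norm (grad f y))\<^sup>2 \<le> 0"
      using euler_step_gain[of "s \<rho> y" \<rho> y] range max \<rho>(2) by simp
    then have "s \<rho> y = \<rho>" using False range by (simp add: mult_le_0_iff)
    then show ?thesis by simp
  qed simp
  show ?thesis by (induction k) (simp_all add: Let_def step)
qed

theorem mainTheorem6:
  fixes f :: "real ^ 'd \<Rightarrow> real"
    and s :: "real \<Rightarrow> real ^ 'd \<Rightarrow> real"
    and z x\<^sub>0 :: "real ^ 'd"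
  assumes "regular_density f"
    and "line_search_rule f s"
    and "is_mode f z"
    and "x\<^sub>0 \<in> basin_of_attraction f z"
  shows "\<exists>\<rho>\<^sub>0>0. \<forall>\<rho>\<in>{0<..\<rho>\<^sub>0}. line_search_shift f s \<rho> x\<^sub>0 \<longlonglongrightarrow> z"
proof -
  obtain L M where lip: "bounded_lipschitz_gradient f (grad f) L M"
    using regular_density_bounded_lipschitz_gradient[OF assms(1)] by blast
  then interpret bounded_lipschitz_gradient f "grad f" L M .
  obtain \<gamma> where \<gamma>: "\<gamma> 0 = x\<^sub>0" "(\<gamma> \<longlongrightarrow> z) at_top"
    and flow: "\<And>t. t \<ge> 0 \<Longrightarrow> (\<gamma> has_vector_derivative grad f (\<gamma> t)) (at t within {0..})"
    using assms(4) by (auto simp: basin_of_attraction_def gradient_flow_line_def)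
  obtain e where e: "e > 0" "\<And>y. y \<in> ball z e \<Longrightarrow> f y \<le> f z"
    using assms(3) by (auto simp: is_mode_def)
  have z0: "grad f z = 0" using gradient_zero_at_local_max[OF e] .
  then have "inj ((*v) (hessian f z))"
    using assms(1) by (simp add: regular_density_def critical_point_def inj_matrix_vector_mult)
  moreover have "(grad f has_derivative (*v) (hessian f z)) (at z)"
    using assms(1) by (intro grad_has_derivative_hessian) (simp add: regular_density_def)
  ultimately obtain r where r: "r > 0" "\<And>y. y \<in> ball z r \<Longrightarrow> grad f y = 0 \<Longrightarrow> y = z"
    using zero_isolated_if_derivative_inj z0 by blast
  have "\<exists>\<rho>\<^sub>0>0. \<forall>\<rho>\<in>{0<..\<rho>\<^sub>0}. euler \<rho> (\<gamma> 0) \<longlonglongrightarrow> z"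
    by (rule euler_tendsto_isolated_max[OF flow \<gamma>(2), of "min e r"]) (use e r in auto)
  then obtain \<rho>1 where \<rho>1: "\<rho>1 > 0" "\<And>\<rho>. \<rho> \<in> {0<..\<rho>1} \<Longrightarrow> euler \<rho> x\<^sub>0 \<longlonglongrightarrow> z"
    using \<gamma>(1) by auto
  have "line_search_shift f s \<rho> x\<^sub>0 \<longlonglongrightarrow> z" if "\<rho> \<in> {0<..min \<rho>1 (1 / (2 * L))}" for \<rho>
  proof -
    have "line_search_shift f s \<rho> x\<^sub>0 = euler \<rho> x\<^sub>0"
      using line_search_eq_euler[OF lip assms(2)] that by auto
    then show ?thesis using \<rho>1(2)[of \<rho>] that by simp
  qed
  then show ?thesis
    using \<rho>1(1) L_pos by (intro exI[of _ "min \<rho>1 (1 / (2 * L))"]) auto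
qed

end
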